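(* Let $X$ be a BCK-algebra. There is a one-to-one correspondence (bijection) between the adjoint pairs of $X$ and the state-morphism operators on $X$.
   Context: A BCK-algebra is an algebra $(X,*,0)$ of type $(2,0)$ such that for all $x,y,z\in X$: $((x*y)*(x*z))*(z*y)=0$; $x*0=x$; $x*y=0$ and $y*x=0$ imply $x=y$; $0*x=0$. A homomorphism is a map preserving $*$ (hence $0$). A state-morphism operator on $X$ is a homomorphism $\mu:X\to X$ with $\mu\circ\mu=\mu$. An ideal of $X$ is a subset $I$ with $0\in I$ such that $y*x\in I$ and $x\in I$ imply $y\in I$. For $S\subseteq X$, $\langle S\rangle$ is the least ideal of $X$ containing $S$. For an ideal $I$, $\theta_I=\{(x,y)\in X\times X: x*y\in I,\ y*x\in I\}$. An adjoint pair of $X$ is a pair $(A,I)$ where $I$ is an ideal of $X$ and $A$ is a subalgebra of $X$ such that: (Ap1) $A\cap I=\{0\}$ and $\langle A\cup I\rangle=X$; (Ap2) for each $x\in X$ there exists $a_x\in A$ with $(x,a_x)\in\theta_I$. *)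

theory Defs
  imports Main "HOL.Hull" "HOL-Library.FuncSet"
begin

locale bck_algebra =
  fixes X :: "'a set"
    and mult :: "'a \<Rightarrow> 'a \<Rightarrow> 'a"  (infixl "\<^bold>*" 70)
    and zero :: "'a"  ("\<^bold>0")
  assumes mult_closed: "\<lbrakk>x \<in> X; y \<in> X\<rbrakk> \<Longrightarrow> x \<^bold>* y \<in> X"
    and zero_closed: "\<^bold>0 \<in> X"
    and bck1: "\<lbrakk>x \<in> X; y \<in> X; z \<in> X\<rbrakk> \<Longrightarrow> ((x \<^bold>* y) \<^bold>* (x \<^bold>* z)) \<^bold>* (z \<^bold>* y) = \<^bold>0"
    and mult_zero: "x \<in> X \<Longrightarrow> x \<^bold>* \<^bold>0 = x"
    and antisym: "\<lbrakk>x \<in> X; y \<in> X; x \<^bold>* y = \<^bold>0; y \<^bold>* x = \<^bold>0\<rbrakk> \<Longrightarrow> x = y"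
    and zero_mult: "x \<in> X \<Longrightarrow> \<^bold>0 \<^bold>* x = \<^bold>0"

text \<open>Maps between carriers are taken in the extensional function space, so that two
  homomorphisms are equal as HOL functions iff they agree on the carrier. Preservation of
  the constant follows from preservation of the product, since \<open>x * x = 0\<close> in every
  BCK-algebra.\<close>

definition bck_hom ::
  "'a set \<Rightarrow> ('a \<Rightarrow> 'a \<Rightarrow> 'a) \<Rightarrow> 'b set \<Rightarrow> ('b \<Rightarrow> 'b \<Rightarrow> 'b) \<Rightarrow> ('a \<Rightarrow> 'b) set" where
  "bck_hom X m Y n = {f \<in> X \<rightarrow>\<^sub>E Y. \<forall>x\<in>X. \<forall>y\<in>X. f (m x y) = n (f x) (f y)}"

context bck_algebra
begin

definition state_morphism_operator :: "('a \<Rightarrow> 'a) \<Rightarrow> bool" where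
  "state_morphism_operator \<mu> \<longleftrightarrow> \<mu> \<in> bck_hom X (\<^bold>*) X (\<^bold>*) \<and> (\<forall>x\<in>X. \<mu> (\<mu> x) = \<mu> x)"

definition bck_subalgebra :: "'a set \<Rightarrow> bool" where
  "bck_subalgebra A \<longleftrightarrow> A \<subseteq> X \<and> \<^bold>0 \<in> A \<and> (\<forall>x\<in>A. \<forall>y\<in>A. x \<^bold>* y \<in> A)"

definition bck_ideal :: "'a set \<Rightarrow> bool" where
  "bck_ideal I \<longleftrightarrow> I \<subseteq> X \<and> \<^bold>0 \<in> I \<and> (\<forall>x\<in>X. \<forall>y\<in>X. y \<^bold>* x \<in> I \<and> x \<in> I \<longrightarrow> y \<in> I)"

definition ideal_generated :: "'a set \<Rightarrow> 'a set" where
  "ideal_generated S = bck_ideal hull S"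

definition ideal_cong :: "'a set \<Rightarrow> ('a \<times> 'a) set"  ("\<theta>") where
  "\<theta> I = {(x, y) \<in> X \<times> X. x \<^bold>* y \<in> I \<and> y \<^bold>* x \<in> I}"

definition adjoint_pair :: "'a set \<times> 'a set \<Rightarrow> bool" where
  "adjoint_pair = (\<lambda>(A, I). bck_ideal I \<and> bck_subalgebra A \<and>
     A \<inter> I = {\<^bold>0} \<and> ideal_generated (A \<union> I) = X \<and>
     (\<forall>x\<in>X. \<exists>a\<in>A. (x, a) \<in> \<theta> I))"

end

end

theory Submission
  imports Defs
begin

text \<open>
  State-morphism operators are the retractions of \<open>X\<close> in the category of BCK-algebras, and
  adjoint pairs are their internal description as split quotients. An operator \<open>\<mu>\<close> corresponds
  to the pair (image of \<open>\<mu>\<close>, kernel of \<open>\<mu>\<close>). In the other direction, the relation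
  \<open>\<theta> I\<close> of an ideal is a congruence (\<open>ideal_cong_mult\<close>), and in an adjoint pair \<open>(A, I)\<close> the
  subalgebra \<open>A\<close> is a transversal of it: every \<open>x\<close> is congruent to some element of \<open>A\<close>, and
  \<open>A \<inter> I = {0}\<close> forces this element to be unique (\<open>representative_unique\<close>). Sending each
  element to its representative in \<open>A\<close> is then an idempotent homomorphism with image \<open>A\<close> and
  kernel \<open>I\<close>. In particular the pair is recovered from the operator. Conversely the operator is
  recovered from its pair, because \<open>\<mu> x\<close> lies in the image of \<open>\<mu>\<close> and is congruent to \<open>x\<close>
  modulo the kernel: both \<open>x * \<mu> x\<close> and \<open>\<mu> x * x\<close> are sent to \<open>\<mu> x * \<mu> x = 0\<close>.
\<close>

section \<open>Ideals and their congruences\<close>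

context bck_algebra
begin

text \<open>The natural order of a BCK-algebra is \<open>x \<le> y \<longleftrightarrow> x * y = 0\<close>. The next lemmas are the parts
  of its elementary theory that make \<open>\<theta> I\<close> a congruence.\<close>

lemma mult_self: "x \<in> X \<Longrightarrow> x \<^bold>* x = \<^bold>0"
  using bck1[of x "\<^bold>0" "\<^bold>0"] by (simp add: mult_zero zero_mult zero_closed mult_closed)

lemma mult_mult_le:
  assumes "x \<in> X" "y \<in> X"
  shows "(x \<^bold>* (x \<^bold>* y)) \<^bold>* y = \<^bold>0"
  using bck1[of x "\<^bold>0" y] assms by (simp add: mult_zero zero_closed)

lemma le_trans:
  assumes "x \<in> X" "y \<in> X" "z \<in> X" "x \<^bold>* y = \<^bold>0" "y \<^bold>* z = \<^bold>0"
  shows "x \<^bold>* z = \<^bold>0"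
  using bck1[of x z y] assms by (simp add: mult_zero mult_closed)

lemma mult_antimono_right:
  assumes "x \<in> X" "y \<in> X" "z \<in> X" "z \<^bold>* y = \<^bold>0"
  shows "(x \<^bold>* y) \<^bold>* (x \<^bold>* z) = \<^bold>0"
  using bck1[of x y z] assms by (simp add: mult_zero mult_closed)

lemma mult_right_commute_le:
  assumes "x \<in> X" "y \<in> X" "z \<in> X"
  shows "((x \<^bold>* y) \<^bold>* z) \<^bold>* ((x \<^bold>* z) \<^bold>* y) = \<^bold>0"
proof (rule le_trans)
  \<comment> \<open>Since \<open>x * (x * z) \<le> z\<close>, replacing \<open>z\<close> by \<open>x * (x * z)\<close> can only enlarge the left side.\<close>
  show "((x \<^bold>* y) \<^bold>* z) \<^bold>* ((x \<^bold>* y) \<^bold>* (x \<^bold>* (x \<^bold>* z))) = \<^bold>0"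
    using assms by (intro mult_antimono_right mult_mult_le mult_closed)
  show "((x \<^bold>* y) \<^bold>* (x \<^bold>* (x \<^bold>* z))) \<^bold>* ((x \<^bold>* z) \<^bold>* y) = \<^bold>0"
    using assms by (intro bck1 mult_closed)
qed (use assms in \<open>auto intro: mult_closed\<close>)

lemma mult_right_commute:
  assumes "x \<in> X" "y \<in> X" "z \<in> X"
  shows "(x \<^bold>* y) \<^bold>* z = (x \<^bold>* z) \<^bold>* y"
  using assms by (auto intro!: antisym[OF _ _ mult_right_commute_le mult_right_commute_le] mult_closed)

text \<open>Exchanging the last two factors in the first BCK axiom turns its bound on how
  \<open>x * y\<close> varies with \<open>y\<close> into one on how it varies with \<open>x\<close>.\<close>

lemma bck1_left:
  assumes "x \<in> X" "y \<in> X" "z \<in> X"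
  shows "((x \<^bold>* y) \<^bold>* (z \<^bold>* y)) \<^bold>* (x \<^bold>* z) = \<^bold>0"
  using bck1[OF assms] mult_right_commute[of "x \<^bold>* y" "x \<^bold>* z" "z \<^bold>* y"] assms
  by (simp add: mult_closed)

lemma ideal_subset: "bck_ideal I \<Longrightarrow> I \<subseteq> X"
  and ideal_zero: "bck_ideal I \<Longrightarrow> \<^bold>0 \<in> I"
  unfolding bck_ideal_def by (elim conjE, assumption)+

lemma ideal_mem:
  assumes "bck_ideal I" "y \<in> X" "y \<^bold>* x \<in> I" "x \<in> I"
  shows "y \<in> I"
proof -
  have "x \<in> X"
    using assms(4) ideal_subset[OF assms(1)] by blast
  moreover have "\<forall>x\<in>X. \<forall>y\<in>X. y \<^bold>* x \<in> I \<and> x \<in> I \<longrightarrow> y \<in> I"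
    using assms(1) unfolding bck_ideal_def by (elim conjE)
  ultimately have "\<forall>y\<in>X. y \<^bold>* x \<in> I \<and> x \<in> I \<longrightarrow> y \<in> I"
    by (rule bspec[rotated])
  from this assms(2) have "y \<^bold>* x \<in> I \<and> x \<in> I \<longrightarrow> y \<in> I"
    by (rule bspec)
  then show ?thesis
    using assms(3,4) by blast
qed

lemma ideal_downward:
  assumes "bck_ideal I" "y \<in> X" "y \<^bold>* x = \<^bold>0" "x \<in> I"
  shows "y \<in> I"
  using ideal_mem[of I y x] ideal_zero[of I] assms by simp

lemma ideal_cong_sym: "(x, y) \<in> \<theta> I \<Longrightarrow> (y, x) \<in> \<theta> I"
  by (simp add: ideal_cong_def)

lemma ideal_cong_refl:
  assumes "bck_ideal I" "x \<in> X"
  shows "(x, x) \<in> \<theta> I"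
  using assms by (simp add: ideal_cong_def ideal_zero mult_self)

lemma ideal_cong_trans:
  assumes I: "bck_ideal I" and "(x, y) \<in> \<theta> I" "(y, z) \<in> \<theta> I"
  shows "(x, z) \<in> \<theta> I"
proof -
  have "a \<^bold>* c \<in> I" if "a \<in> X" "b \<in> X" "c \<in> X" "a \<^bold>* b \<in> I" "b \<^bold>* c \<in> I" for a b c
  proof -
    have "(a \<^bold>* c) \<^bold>* (a \<^bold>* b) \<in> I"
      using that by (intro ideal_downward[OF I _ bck1] mult_closed)
    then show ?thesis
      using that mult_closed by (auto intro: ideal_mem[OF I, of "a \<^bold>* c" "a \<^bold>* b"])
  qed
  then show ?thesis
    using assms(2,3) unfolding ideal_cong_def by blast
qed

lemma ideal_cong_mult:
  assumes I: "bck_ideal I" and xx': "(x, x') \<in> \<theta> I" and yy': "(y, y') \<in> \<theta> I"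
  shows "(x \<^bold>* y, x' \<^bold>* y') \<in> \<theta> I"
proof (rule ideal_cong_trans[OF I])
  have X: "x \<in> X" "x' \<in> X" "y \<in> X" "y' \<in> X"
    and mem: "x \<^bold>* x' \<in> I" "x' \<^bold>* x \<in> I" "y \<^bold>* y' \<in> I" "y' \<^bold>* y \<in> I"
    using xx' yy' by (auto simp: ideal_cong_def)
  have "(x \<^bold>* y) \<^bold>* (x' \<^bold>* y) \<in> I" "(x' \<^bold>* y) \<^bold>* (x \<^bold>* y) \<in> I"
    using X mem by (auto intro!: ideal_downward[OF I _ bck1_left] mult_closed)
  then show "(x \<^bold>* y, x' \<^bold>* y) \<in> \<theta> I"
    using X by (simp add: ideal_cong_def mult_closed)
  have "(x' \<^bold>* y) \<^bold>* (x' \<^bold>* y') \<in> I" "(x' \<^bold>* y') \<^bold>* (x' \<^bold>* y) \<in> I"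
    using X mem by (auto intro!: ideal_downward[OF I _ bck1] mult_closed)
  then show "(x' \<^bold>* y, x' \<^bold>* y') \<in> \<theta> I"
    using X by (simp add: ideal_cong_def mult_closed)
qed

lemma ideal_cong_zero_iff:
  assumes "bck_ideal I" "x \<in> X"
  shows "(x, \<^bold>0) \<in> \<theta> I \<longleftrightarrow> x \<in> I"
  using assms by (auto simp: ideal_cong_def ideal_zero mult_zero zero_mult zero_closed)

section \<open>From adjoint pairs to operators\<close>

definition pair_operator :: "'a set \<times> 'a set \<Rightarrow> 'a \<Rightarrow> 'a" where
  "pair_operator = (\<lambda>(A, I). \<lambda>x\<in>X. THE a. a \<in> A \<and> (x, a) \<in> \<theta> I)"

definition operator_pair :: "('a \<Rightarrow> 'a) \<Rightarrow> 'a set \<times> 'a set" where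
  "operator_pair \<mu> = (\<mu> ` X, {x \<in> X. \<mu> x = \<^bold>0})"

lemma adjoint_pairD:
  assumes "adjoint_pair (A, I)"
  shows "bck_ideal I" "bck_subalgebra A" "A \<inter> I = {\<^bold>0}"
    "x \<in> X \<Longrightarrow> \<exists>a\<in>A. (x, a) \<in> \<theta> I"
  using assms by (auto simp: adjoint_pair_def)

text \<open>For congruent \<open>a, b \<in> A\<close>, both \<open>a * b\<close> and \<open>b * a\<close> lie in \<open>A \<inter> I\<close>, hence vanish.\<close>

lemma representative_unique:
  assumes P: "adjoint_pair (A, I)" and "a \<in> A" "b \<in> A" "(x, a) \<in> \<theta> I" "(x, b) \<in> \<theta> I"
  shows "a = b"
proof -
  note D = adjoint_pairD[OF P]
  have ab: "(a, b) \<in> \<theta> I"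
    using assms ideal_cong_trans[OF D(1)] ideal_cong_sym by blast
  have "a \<^bold>* b \<in> A \<inter> I" "b \<^bold>* a \<in> A \<inter> I"
    using ab assms(2,3) D(2) by (auto simp: ideal_cong_def bck_subalgebra_def)
  then show ?thesis
    using ab D(3) antisym by (auto simp: ideal_cong_def)
qed

lemma pair_operator_eqI:
  assumes "adjoint_pair (A, I)" "a \<in> A" "(x, a) \<in> \<theta> I"
  shows "pair_operator (A, I) x = a"
proof -
  have "(THE a. a \<in> A \<and> (x, a) \<in> \<theta> I) = a"
    using assms representative_unique by (intro the_equality) auto
  then show ?thesis
    using assms(3) by (simp add: pair_operator_def ideal_cong_def)
qed

lemma pair_operator_representative:
  assumes "adjoint_pair (A, I)" "x \<in> X"
  shows "pair_operator (A, I) x \<in> A" "(x, pair_operator (A, I) x) \<in> \<theta> I"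
  using adjoint_pairD(4)[OF assms] pair_operator_eqI[OF assms(1)] by auto

lemma pair_operator_fixes:
  assumes "adjoint_pair (A, I)" "a \<in> A"
  shows "pair_operator (A, I) a = a"
  using adjoint_pairD(1,2)[OF assms(1)] assms
  by (intro pair_operator_eqI ideal_cong_refl) (auto simp: bck_subalgebra_def)

text \<open>As \<open>A\<close> is a subalgebra and \<open>\<theta> I\<close> a congruence, the product of the representatives of \<open>x\<close>
  and \<open>y\<close> is a representative of \<open>x * y\<close>; uniqueness makes it the chosen one.\<close>

lemma state_morphism_pair_operator:
  assumes P: "adjoint_pair (A, I)"
  shows "state_morphism_operator (pair_operator (A, I))"
proof -
  let ?\<mu> = "pair_operator (A, I)"
  note D = adjoint_pairD[OF P] and rep = pair_operator_representative[OF P]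
  have "?\<mu> \<in> X \<rightarrow>\<^sub>E X"
    using rep(1) D(2) by (auto simp: bck_subalgebra_def) (simp add: pair_operator_def)
  moreover have "?\<mu> (x \<^bold>* y) = ?\<mu> x \<^bold>* ?\<mu> y" if "x \<in> X" "y \<in> X" for x y
    using rep[of x] rep[of y] that D(2)
    by (intro pair_operator_eqI[OF P] ideal_cong_mult[OF D(1)]) (auto simp: bck_subalgebra_def)
  moreover have "?\<mu> (?\<mu> x) = ?\<mu> x" if "x \<in> X" for x
    using pair_operator_fixes[OF P] rep(1) that by blast
  ultimately show ?thesis
    by (simp add: state_morphism_operator_def bck_hom_def)
qed

lemma operator_pair_pair_operator:
  assumes P: "adjoint_pair (A, I)"
  shows "operator_pair (pair_operator (A, I)) = (A, I)"
proof -
  let ?\<mu> = "pair_operator (A, I)"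
  note D = adjoint_pairD[OF P] and rep = pair_operator_representative[OF P]
  have AX: "A \<subseteq> X" "\<^bold>0 \<in> A" and IX: "I \<subseteq> X"
    using D(2) ideal_subset[OF D(1)] by (auto simp: bck_subalgebra_def)
  have "?\<mu> ` X = A"
    using rep(1) pair_operator_fixes[OF P] AX(1) by (force simp: image_iff)
  moreover have "?\<mu> x = \<^bold>0 \<longleftrightarrow> x \<in> I" if "x \<in> X" for x
    using rep(2)[OF that] pair_operator_eqI[OF P AX(2), of x] ideal_cong_zero_iff[OF D(1) that]
    by auto
  ultimately show ?thesis
    using IX by (auto simp: operator_pair_def)
qed

section \<open>From operators to adjoint pairs\<close>

lemma state_morphismD:
  assumes "state_morphism_operator \<mu>"
  shows "\<mu> \<in> X \<rightarrow>\<^sub>E X" "x \<in> X \<Longrightarrow> \<mu> x \<in> X"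
    "\<lbrakk>x \<in> X; y \<in> X\<rbrakk> \<Longrightarrow> \<mu> (x \<^bold>* y) = \<mu> x \<^bold>* \<mu> y"
    "x \<in> X \<Longrightarrow> \<mu> (\<mu> x) = \<mu> x"
  using assms by (auto simp: state_morphism_operator_def bck_hom_def)

lemma state_morphism_zero:
  assumes "state_morphism_operator \<mu>"
  shows "\<mu> \<^bold>0 = \<^bold>0"
  using state_morphismD(3)[OF assms, of "\<^bold>0" "\<^bold>0"] state_morphismD(2)[OF assms, of "\<^bold>0"]
  by (simp add: mult_self zero_closed)

lemma operator_cong_kernel:
  assumes "state_morphism_operator \<mu>" "x \<in> X"
  shows "(x, \<mu> x) \<in> \<theta> {x \<in> X. \<mu> x = \<^bold>0}"
  using state_morphismD[OF assms(1)] assms(2) by (simp add: ideal_cong_def mult_closed mult_self)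

text \<open>An ideal containing the image and the kernel of \<open>\<mu>\<close> contains \<open>\<mu> x\<close> and \<open>x * \<mu> x\<close>, hence
  \<open>x\<close>; so the image and the kernel generate \<open>X\<close>.\<close>

lemma adjoint_pair_operator_pair:
  assumes \<mu>: "state_morphism_operator \<mu>"
  shows "adjoint_pair (operator_pair \<mu>)"
proof -
  note D = state_morphismD[OF \<mu>] and z = state_morphism_zero[OF \<mu>]
  let ?A = "\<mu> ` X" and ?I = "{x \<in> X. \<mu> x = \<^bold>0}"
  have cong: "\<exists>a\<in>?A. (x, a) \<in> \<theta> ?I" if "x \<in> X" for x
    using operator_cong_kernel[OF \<mu> that] that by blast
  have "\<mu> y = \<^bold>0" if "x \<in> X" "y \<in> X" "\<mu> (y \<^bold>* x) = \<^bold>0" "\<mu> x = \<^bold>0" for x y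
    using D(3)[of y x] mult_zero[OF D(2)[of y]] that by simp
  then have "bck_ideal ?I"
    using z by (auto simp: bck_ideal_def zero_closed)
  moreover have "bck_subalgebra ?A"
    unfolding bck_subalgebra_def
  proof (intro conjI ballI)
    show "?A \<subseteq> X"
      using D(2) by blast
    show "\<^bold>0 \<in> ?A"
      using z zero_closed by (metis imageI)
    show "a \<^bold>* b \<in> ?A" if "a \<in> ?A" "b \<in> ?A" for a b
      using that D(3) mult_closed by (metis (no_types, lifting) imageE imageI)
  qed
  moreover have "?A \<inter> ?I = {\<^bold>0}"
    using D z zero_closed by (auto simp: image_iff) (metis)
  moreover have "ideal_generated (?A \<union> ?I) = X"
    unfolding ideal_generated_def
  proof (rule hull_unique)
    show "?A \<union> ?I \<subseteq> X"
      using D(2) by auto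
    show "bck_ideal X"
      by (auto simp: bck_ideal_def zero_closed)
    show "X \<subseteq> J" if J: "?A \<union> ?I \<subseteq> J" "bck_ideal J" for J
    proof
      fix x assume x: "x \<in> X"
      have "x \<^bold>* \<mu> x \<in> J" "\<mu> x \<in> J"
        using operator_cong_kernel[OF \<mu> x] x J(1) by (auto simp: ideal_cong_def)
      then show "x \<in> J"
        using ideal_mem[OF J(2) x] by blast
    qed
  qed
  ultimately show ?thesis
    using cong by (simp add: adjoint_pair_def operator_pair_def)
qed

lemma pair_operator_operator_pair:
  assumes \<mu>: "state_morphism_operator \<mu>"
  shows "pair_operator (operator_pair \<mu>) = \<mu>"
proof (rule PiE_ext)
  note P = adjoint_pair_operator_pair[OF \<mu>, unfolded operator_pair_def]
  show "pair_operator (operator_pair \<mu>) \<in> X \<rightarrow>\<^sub>E X"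
    using state_morphismD(1)[OF state_morphism_pair_operator[OF P]]
    by (simp add: operator_pair_def)
  show "\<mu> \<in> X \<rightarrow>\<^sub>E X"
    by (rule state_morphismD(1)[OF \<mu>])
  show "pair_operator (operator_pair \<mu>) x = \<mu> x" if "x \<in> X" for x
    using pair_operator_eqI[OF P _ operator_cong_kernel[OF \<mu> that]] that
    by (simp add: operator_pair_def)
qed

theorem bij_betw_pair_operator:
  "bij_betw pair_operator {P. adjoint_pair P} {\<mu>. state_morphism_operator \<mu>}"
proof (rule bij_betw_byWitness[where f' = operator_pair])
  show "\<forall>P\<in>{P. adjoint_pair P}. operator_pair (pair_operator P) = P"
    using operator_pair_pair_operator by auto
  show "\<forall>\<mu>\<in>{\<mu>. state_morphism_operator \<mu>}. pair_operator (operator_pair \<mu>) = \<mu>"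
    using pair_operator_operator_pair by blast
  show "pair_operator ` {P. adjoint_pair P} \<subseteq> {\<mu>. state_morphism_operator \<mu>}"
    using state_morphism_pair_operator by auto
  show "operator_pair ` {\<mu>. state_morphism_operator \<mu>} \<subseteq> {P. adjoint_pair P}"
    using adjoint_pair_operator_pair by blast
qed

end

theorem theorem4p14:
  fixes X :: "'a set" and mult :: "'a \<Rightarrow> 'a \<Rightarrow> 'a" and zero :: 'a
  assumes "bck_algebra X mult zero"
  shows "\<exists>F. bij_betw F {P. bck_algebra.adjoint_pair X mult zero P}
                       {\<mu>. bck_algebra.state_morphism_operator X mult \<mu>}"
  using bck_algebra.bij_betw_pair_operator[OF assms] by blast

end
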